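(* For every term $e$: $\mathrm{eval}_{need}(e) = \texttt{done}$ if and only if $\mathrm{eval}^{sr}_{need}(e) = \texttt{done}$; i.e. $\mathrm{eval}_{need} = \mathrm{eval}^{sr}_{need}$, where $\mathrm{eval}_{need}(e)=\texttt{done}$ iff there is an answer $a$ with $\lambda_{need}\vdash e = a$, and $\mathrm{eval}^{sr}_{need}(e)=\texttt{done}$ iff there is an answer $a$ with $e \mapsto^{*} a$.
   Context: Terms: $e ::= x \mid \lambda x.e \mid e\,e$ (modulo $\alpha$-equivalence, Barendregt's variable convention). Values: $v ::= \lambda x.e$. A context is a term with one hole $[\,]$; $C[e]$ is plugging, $C_1[C_2]$ composition. Answer contexts: $A ::= [\,] \mid A[\lambda x.A]\,e$. Answers: $a ::= A[v]$. Outer partial answer contexts: $A^{\uparrow} ::= [\,] \mid A[A^{\uparrow}]\,e$. Inner partial answer contexts: $A^{\downarrow} ::= [\,] \mid A[\lambda x.A^{\downarrow}]$. Evaluation contexts: $E ::= [\,] \mid E\,e \mid A[E] \mid A^{\uparrow}[A[\lambda x.A^{\downarrow}[E[x]]]\,E]$, where in the last production $A^{\uparrow}[A^{\downarrow}]$ must be an answer context. Axiom $\beta_{need}$: $A^{\uparrow}[A_1[\lambda x.A^{\downarrow}[E[x]]]\,A_2[v]] \;\beta_{need}\; A^{\uparrow}[A_1[A_2[(A^{\downarrow}[E[x]])\{x:=v\}]]]$ provided $A^{\uparrow}[A^{\downarrow}]$ is an answer context ($\{x:=v\}$ is capture-avoiding substitution for all free occurrences of $x$). $\lambda_{need}\vdash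 e_1 = e_2$ means $e_1,e_2$ are related by the least equivalence relation containing the compatible closure of $\beta_{need}$ (closure under contexts $C ::= [\,] \mid \lambda x.C \mid C\,e \mid e\,C$). Standard reduction: $E[e] \mapsto E[e']$ for every evaluation context $E$ whenever $e\;\beta_{need}\;e'$; $\mapsto^{*}$ is its reflexive–transitive closure. *)

theory Defs
  imports Main
begin

datatype dB = Var nat | Lam dB | App dB dB

fun lift :: "nat \<Rightarrow> nat \<Rightarrow> dB \<Rightarrow> dB" where
  "lift k c (Var i) = (if i < c then Var i else Var (i + k))"
| "lift k c (Lam t) = Lam (lift k (Suc c) t)"
| "lift k c (App s t) = App (lift k c s) (lift k c t)"

fun subst :: "dB \<Rightarrow> nat \<Rightarrow> dB \<Rightarrow> dB" where
  "subst (Var i) x s = (if i < x then Var i else if i = x then s else Var (i - 1))"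
| "subst (Lam t) x s = Lam (subst t (Suc x) (lift 1 0 s))"
| "subst (App t u) x s = App (subst t x s) (subst u x s)"

datatype ctx = Hole | CLam ctx | CAppL ctx dB | CAppR dB ctx

fun plug :: "ctx \<Rightarrow> dB \<Rightarrow> dB" where
  "plug Hole e = e"
| "plug (CLam C) e = Lam (plug C e)"
| "plug (CAppL C u) e = App (plug C e) u"
| "plug (CAppR u C) e = App u (plug C e)"

fun cplug :: "ctx \<Rightarrow> ctx \<Rightarrow> ctx" where
  "cplug Hole D = D"
| "cplug (CLam C) D = CLam (cplug C D)"
| "cplug (CAppL C u) D = CAppL (cplug C D) u"
| "cplug (CAppR u C) D = CAppR u (cplug C D)"

fun depth :: "ctx \<Rightarrow> nat" where
  "depth Hole = 0"
| "depth (CLam C) = Suc (depth C)"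
| "depth (CAppL C u) = depth C"
| "depth (CAppR u C) = depth C"

fun lift_ctx :: "nat \<Rightarrow> nat \<Rightarrow> ctx \<Rightarrow> ctx" where
  "lift_ctx k c Hole = Hole"
| "lift_ctx k c (CLam C) = CLam (lift_ctx k (Suc c) C)"
| "lift_ctx k c (CAppL C u) = CAppL (lift_ctx k c C) (lift k c u)"
| "lift_ctx k c (CAppR u C) = CAppR (lift k c u) (lift_ctx k c C)"

inductive ans_ctx :: "ctx \<Rightarrow> bool" where
  "ans_ctx Hole"
| "ans_ctx A1 \<Longrightarrow> ans_ctx A2 \<Longrightarrow> ans_ctx (CAppL (cplug A1 (CLam A2)) e)"

inductive outer_ctx :: "ctx \<Rightarrow> bool" where
  "outer_ctx Hole"
| "ans_ctx A \<Longrightarrow> outer_ctx Au \<Longrightarrow> outer_ctx (CAppL (cplug A Au) e)"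

inductive inner_ctx :: "ctx \<Rightarrow> bool" where
  "inner_ctx Hole"
| "ans_ctx A \<Longrightarrow> inner_ctx Ad \<Longrightarrow> inner_ctx (cplug A (CLam Ad))"

definition is_value :: "dB \<Rightarrow> bool" where
  "is_value t \<longleftrightarrow> (\<exists>b. t = Lam b)"

definition is_answer :: "dB \<Rightarrow> bool" where
  "is_answer t \<longleftrightarrow> (\<exists>A v. ans_ctx A \<and> is_value v \<and> t = plug A v)"

(* E ::= [] | E e | A[E] | A^up[A[\<lambda>x.A^down[E[x]]] E]   (A^up[A^down] an answer context).
   The variable x bound by the displayed \<lambda> is, at the hole of A^down[E],
   the de Bruijn index depth A^down + depth E. *)
inductive eval_ctx :: "ctx \<Rightarrow> bool" where
  "eval_ctx Hole"
| "eval_ctx E \<Longrightarrow> eval_ctx (CAppL E e)"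
| "ans_ctx A \<Longrightarrow> eval_ctx E \<Longrightarrow> eval_ctx (cplug A E)"
| "outer_ctx Au \<Longrightarrow> ans_ctx A \<Longrightarrow> inner_ctx Ad \<Longrightarrow> eval_ctx E1 \<Longrightarrow> eval_ctx E2 \<Longrightarrow>
   ans_ctx (cplug Au Ad) \<Longrightarrow>
   eval_ctx (cplug Au (CAppR (plug A (Lam (plug Ad (plug E1 (Var (depth Ad + depth E1)))))) E2))"

(* beta_need:
   A^up[A1[\<lambda>x.A^down[E[x]]] A2[v]]  -->  A^up[A1[A2[(A^down[E[x]]){x:=v}]]]
   In de Bruijn form, moving A2 under A1 lifts A2's free indices by depth A1,
   v (under A2) is lifted by depth A1 above cutoff depth A2, and the body's
   free indices other than x are lifted by depth A2 (they now sit under A2). *)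
inductive beta_need :: "dB \<Rightarrow> dB \<Rightarrow> bool" where
  "outer_ctx Au \<Longrightarrow> ans_ctx A1 \<Longrightarrow> inner_ctx Ad \<Longrightarrow> eval_ctx E \<Longrightarrow> ans_ctx A2 \<Longrightarrow>
   is_value v \<Longrightarrow> ans_ctx (cplug Au Ad) \<Longrightarrow>
   body = plug Ad (plug E (Var (depth Ad + depth E))) \<Longrightarrow>
   beta_need
     (plug Au (App (plug A1 (Lam body)) (plug A2 v)))
     (plug Au (plug A1 (plug (lift_ctx (depth A1) 0 A2)
        (subst (lift (depth A2) 1 body) 0 (lift (depth A1) (depth A2) v)))))"

inductive need_step :: "dB \<Rightarrow> dB \<Rightarrow> bool" where
  "beta_need s t \<Longrightarrow> need_step s t"
| "need_step s t \<Longrightarrow> need_step (Lam s) (Lam t)"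
| "need_step s t \<Longrightarrow> need_step (App s u) (App t u)"
| "need_step s t \<Longrightarrow> need_step (App u s) (App u t)"

definition need_eq :: "dB \<Rightarrow> dB \<Rightarrow> bool" where
  "need_eq = equivclp need_step"

definition sr_step :: "dB \<Rightarrow> dB \<Rightarrow> bool" where
  "sr_step s t \<longleftrightarrow> (\<exists>E e e'. eval_ctx E \<and> beta_need e e' \<and> s = plug E e \<and> t = plug E e')"

definition eval_need_done :: "dB \<Rightarrow> bool" where
  "eval_need_done e \<longleftrightarrow> (\<exists>a. is_answer a \<and> need_eq e a)"

definition eval_sr_need_done :: "dB \<Rightarrow> bool" where
  "eval_sr_need_done e \<longleftrightarrow> (\<exists>a. is_answer a \<and> sr_step\<^sup>*\<^sup>* e a)"

end

theory Submission
  imports Defs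
begin

text \<open>
  The standard reduction of a term is computed from its head: walk down the spine, counting the
  arguments that are pending, and jump into an argument whenever the variable bound to it is
  demanded. This classification is a function of the term and of the number of pending
  arguments, so standard reduction is deterministic, and it is stable under instantiation of every
  variable except the demanded one.

  In the style of Kashima, s standardises to t if s reaches the outermost constructor of t by
  standard steps and the components standardise recursively. Every need step has this form.
  The relation absorbs standard steps of its target (which transports termination from t back
  to s), and standard steps of its source commute with it, because a source that cannot take a
  standard step has the same head as its target (which transports termination from s to t). Hence
  reaching an answer by standard reduction is invariant under the equational theory.

  A detour through call-by-name is not possible: with values V and u, the term
  ((\<lambda>w. (\<lambda>x. \<lambda>z. x) w) V) u has a call-by-name value but is irreducible in this calculus. The demand
  for w passes through an argument position, and the function there consumes an
  argument supplied outside the binding of w, which the evaluation contexts do not allow.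
\<close>

section \<open>Simultaneous substitution\<close>

fun up_ren :: "(nat \<Rightarrow> nat) \<Rightarrow> nat \<Rightarrow> nat" where
  "up_ren \<xi> 0 = 0"
| "up_ren \<xi> (Suc i) = Suc (\<xi> i)"

fun ren :: "dB \<Rightarrow> (nat \<Rightarrow> nat) \<Rightarrow> dB" where
  "ren (Var i) \<xi> = Var (\<xi> i)"
| "ren (Lam t) \<xi> = Lam (ren t (up_ren \<xi>))"
| "ren (App t u) \<xi> = App (ren t \<xi>) (ren u \<xi>)"

fun up :: "(nat \<Rightarrow> dB) \<Rightarrow> nat \<Rightarrow> dB" where
  "up \<sigma> 0 = Var 0"
| "up \<sigma> (Suc i) = ren (\<sigma> i) Suc"

fun inst :: "dB \<Rightarrow> (nat \<Rightarrow> dB) \<Rightarrow> dB" where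
  "inst (Var i) \<sigma> = \<sigma> i"
| "inst (Lam t) \<sigma> = Lam (inst t (up \<sigma>))"
| "inst (App t u) \<sigma> = App (inst t \<sigma>) (inst u \<sigma>)"

lemma up_ren_comp: "up_ren \<zeta> (up_ren \<xi> i) = up_ren (\<lambda>j. \<zeta> (\<xi> j)) i"
  by (cases i) auto

lemma up_Var: "up (\<lambda>j. Var (\<xi> j)) = (\<lambda>i. Var (up_ren \<xi> i))"
proof
  fix i show "up (\<lambda>j. Var (\<xi> j)) i = Var (up_ren \<xi> i)" by (cases i) auto
qed

lemma ren_eq_inst: "ren t \<xi> = inst t (\<lambda>i. Var (\<xi> i))"
  by (induction t arbitrary: \<xi>) (auto simp: up_Var)

lemma ren_ren: "ren (ren t \<xi>) \<zeta> = ren t (\<lambda>i. \<zeta> (\<xi> i))"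
  by (induction t arbitrary: \<xi> \<zeta>) (auto simp: up_ren_comp)

lemma inst_ren: "inst (ren t \<xi>) \<sigma> = inst t (\<lambda>i. \<sigma> (\<xi> i))"
proof (induction t arbitrary: \<xi> \<sigma>)
  case (Lam t)
  have "(\<lambda>i. up \<sigma> (up_ren \<xi> i)) = up (\<lambda>i. \<sigma> (\<xi> i))"
  proof
    fix i show "up \<sigma> (up_ren \<xi> i) = up (\<lambda>i. \<sigma> (\<xi> i)) i" by (cases i) auto
  qed
  then show ?case using Lam by simp
qed auto

lemma ren_inst: "ren (inst t \<sigma>) \<xi> = inst t (\<lambda>i. ren (\<sigma> i) \<xi>)"
proof (induction t arbitrary: \<xi> \<sigma>)
  case (Lam t)
  have "(\<lambda>i. ren (up \<sigma> i) (up_ren \<xi>)) = up (\<lambda>i. ren (\<sigma> i) \<xi>)"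
  proof
    fix i show "ren (up \<sigma> i) (up_ren \<xi>) = up (\<lambda>i. ren (\<sigma> i) \<xi>) i"
      by (cases i) (auto simp: ren_ren)
  qed
  then show ?case using Lam by simp
qed auto

lemma inst_inst: "inst (inst t \<sigma>) \<tau> = inst t (\<lambda>i. inst (\<sigma> i) \<tau>)"
proof (induction t arbitrary: \<sigma> \<tau>)
  case (Lam t)
  have "(\<lambda>i. inst (up \<sigma> i) (up \<tau>)) = up (\<lambda>i. inst (\<sigma> i) \<tau>)"
  proof
    fix i show "inst (up \<sigma> i) (up \<tau>) = up (\<lambda>i. inst (\<sigma> i) \<tau>) i"
      by (cases i) (auto simp: inst_ren ren_inst)
  qed
  then show ?case using Lam by simp
qed auto

lemma inst_Var: "inst t Var = t"
proof (induction t)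
  case (Lam t)
  have "up Var = Var" 
  proof
    fix i show "up Var i = Var i" by (cases i) auto
  qed
  then show ?case using Lam by simp
qed auto

lemma lift_eq_ren: "lift k c t = ren t (\<lambda>i. if i < c then i else i + k)"
proof (induction t arbitrary: c)
  case (Lam t)
  have "up_ren (\<lambda>i. if i < c then i else i + k) = (\<lambda>i. if i < Suc c then i else i + k)"
  proof
    fix i
    show "up_ren (\<lambda>i. if i < c then i else i + k) i = (if i < Suc c then i else i + k)"
      by (cases i) auto
  qed
  then show ?case using Lam by simp
qed auto

lemma lift_1_eq_ren: "lift 1 0 t = ren t Suc"
  by (simp add: lift_eq_ren)

lemma lift_lift_0: "lift k 0 (lift k' 0 t) = lift (k + k') 0 t"
  by (simp add: lift_eq_ren ren_ren add_ac)

lemma lift_lift_1: "lift k 1 (lift k' 1 t) = lift (k + k') 1 t"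
proof -
  have "(\<lambda>i. if (if i < 1 then i else i + k') < 1 then if i < 1 then i else i + k'
             else (if i < 1 then i else i + k') + k) = (\<lambda>i. if i < 1 then i else i + (k + k'))"
    by auto
  then show ?thesis by (simp only: lift_eq_ren ren_ren)
qed

lemma lift_0 [simp]: "lift 0 c t = t"
  by (induction t arbitrary: c) auto

definition single :: "nat \<Rightarrow> dB \<Rightarrow> nat \<Rightarrow> dB" where
  "single x s i = (if i < x then Var i else if i = x then s else Var (i - 1))"

lemma subst_eq_inst: "subst t x s = inst t (single x s)"
proof (induction t arbitrary: x s)
  case (Lam t)
  have "up (single x s) = single (Suc x) (lift 1 0 s)"
  proof
    fix i show "up (single x s) i = single (Suc x) (lift 1 0 s) i"
      by (cases i) (auto simp: lift_eq_ren single_def)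
  qed
  then show ?case using Lam by simp
qed (auto simp: single_def)

lemma inst_subst_0: "inst (subst b 0 s) \<sigma> = subst (inst b (up \<sigma>)) 0 (inst s \<sigma>)"
proof -
  have "inst (single 0 s i) \<sigma> = inst (up \<sigma> i) (single 0 (inst s \<sigma>))" for i
    by (cases i) (auto simp: single_def inst_ren inst_Var)
  then show ?thesis by (simp add: subst_eq_inst inst_inst)
qed

lemma inst_lift_0: "inst (lift 1 0 t) (up \<sigma>) = lift 1 0 (inst t \<sigma>)"
  unfolding lift_1_eq_ren by (simp add: inst_ren ren_inst)

lemma inst_lift_1: "inst (lift 1 1 t) (up (up \<sigma>)) = lift 1 1 (inst t (up \<sigma>))"
proof -
  have "up (up \<sigma>) (if i < 1 then i else i + 1) = ren (up \<sigma> i) (\<lambda>i. if i < 1 then i else i + 1)" for i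
    by (cases i) (auto simp: ren_ren)
  then show ?thesis by (simp only: lift_eq_ren inst_ren ren_inst)
qed

section \<open>Status of a term under pending arguments\<close>

text \<open>
  The head of a term with l pending arguments. The value Pend j p says that the j-th
  pending argument (counted from the innermost) is demanded; Free x p q that the free variable x
  is. Here p is the least number of pending arguments along the spine. In Free x p q, the
  number q is the same minimum inside the function at whose argument the spine is first left
  (or just the final level if it never is). The variable may be bound by an abstraction
  around the term only if p \<le> q: otherwise that function consumes an argument from outside the
  binding, and the term is stuck, with head Bad.
\<close>

datatype head = Ans | Red | Bad | Free nat nat nat | Pend nat nat

fun status :: "nat \<Rightarrow> dB \<Rightarrow> head" where
  "status l (Var x) = Free x l l"
| "status 0 (Lam b) = Ans"
| "status (Suc l) (Lam b) = (case status l b of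
      Free x p q \<Rightarrow> (case x of 0 \<Rightarrow> if p \<le> q then Pend 0 p else Bad | Suc y \<Rightarrow> Free y p q)
    | Pend j p \<Rightarrow> Pend (Suc j) p
    | s \<Rightarrow> s)"
| "status l (App f u) = (case status (Suc l) f of
      Pend j p \<Rightarrow> (case j of
          0 \<Rightarrow> (case status 0 u of Ans \<Rightarrow> Red | Red \<Rightarrow> Red | Free x _ _ \<Rightarrow> Free x l p | _ \<Rightarrow> Bad)
        | Suc i \<Rightarrow> Pend i p)
    | Free x p q \<Rightarrow> Free x (min l p) q
    | s \<Rightarrow> s)"

text \<open>
  With m = 0, contr rewrites A1[\<lambda>x.b] applied to A2[v] to A1[A2[b{x:=v}]], and into is the part
  A2[b{x:=v}]; m counts the applications of A1 (or A2) still waiting for their abstraction.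
  On terms of any other shape the results are junk.
\<close>

fun into :: "nat \<Rightarrow> dB \<Rightarrow> dB \<Rightarrow> dB" where
  "into m (Var x) b = Var x"
| "into 0 (Lam c) b = subst b 0 (Lam c)"
| "into (Suc m) (Lam t) b = Lam (into m t (lift 1 1 b))"
| "into m (App t s) b = App (into (Suc m) t b) s"

fun contr :: "nat \<Rightarrow> dB \<Rightarrow> dB \<Rightarrow> dB" where
  "contr m (Var x) u = Var x"
| "contr 0 (Lam b) u = into 0 u b"
| "contr (Suc m) (Lam b) u = Lam (contr m b (lift 1 0 u))"
| "contr m (App t s) u = App (contr (Suc m) t u) s"

text \<open>Meant for \<open>status l t = Red\<close>: the tests then locate the redex in the
  function, at the application itself, or in the demanded argument.\<close>

fun std :: "nat \<Rightarrow> dB \<Rightarrow> dB" where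
  "std l (Var x) = Var x"
| "std 0 (Lam b) = Lam b"
| "std (Suc l) (Lam b) = Lam (std l b)"
| "std l (App f u) = (if status (Suc l) f = Red then App (std (Suc l) f) u
     else if status 0 u = Ans then contr 0 f u else App f (std 0 u))"

fun shift :: "head \<Rightarrow> head" where
  "shift (Free x p q) = Free x (Suc p) (Suc q)"
| "shift (Pend j p) = Pend j (Suc p)"
| "shift s = s"

text \<open>Running out of arguments means \<open>Ans\<close>; any other head is found without
  touching an argument added on the outside.\<close>

lemma status_Suc: "status l t \<noteq> Ans \<Longrightarrow> status (Suc l) t = shift (status l t)"
proof (induction l t rule: status.induct)
  case (3 l b)
  then show ?case by (cases "status l b") (auto split: nat.splits)
next
  case (4 l f u)
  show ?case
  proof (cases "status (Suc l) f")
    case (Pend j p)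
    then have "status (Suc (Suc l)) f = Pend j (Suc p)" using 4(1) by simp
    then show ?thesis using Pend by (cases j; cases "status 0 u") simp_all
  qed (use 4(1,3) in simp_all)
qed simp_all

lemma status_App_Red_cases:
  assumes "status l (App f u) = Red"
  obtains (func) "status (Suc l) f = Red"
    | (redex) p where "status (Suc l) f = Pend 0 p" "status 0 u = Ans"
    | (arg) p where "status (Suc l) f = Pend 0 p" "status 0 u = Red"
proof (cases "status (Suc l) f")
  case (Pend j p)
  with assms have "j = 0 \<and> (status 0 u = Ans \<or> status 0 u = Red)"
    by (cases j; cases "status 0 u") simp_all
  then show ?thesis using Pend redex arg by blast
qed (use assms func in simp_all)

lemma status_App_Ans [simp]: "status l (App f u) = Ans \<longleftrightarrow> status (Suc l) f = Ans"
  by (cases "status (Suc l) f"; cases "status 0 u") (auto split: nat.splits)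

lemma status_App_Pend [simp]: "status l (App f u) = Pend j p \<longleftrightarrow> status (Suc l) f = Pend (Suc j) p"
  by (cases "status (Suc l) f"; cases "status 0 u") (auto split: nat.splits)

lemma status_Lam_Ans [simp]: "status (Suc l) (Lam b) = Ans \<longleftrightarrow> status l b = Ans"
  by (cases "status l b") (auto split: nat.splits)

lemma status_Lam_Red [simp]: "status (Suc l) (Lam b) = Red \<longleftrightarrow> status l b = Red"
  by (cases "status l b") (auto split: nat.splits)

lemma status_Lam_Pend_Suc [simp]:
  "status (Suc l) (Lam b) = Pend (Suc j) p \<longleftrightarrow> status l b = Pend j p"
  by (cases "status l b") (auto split: nat.splits)

lemma status_Lam_Pend_0 [simp]:
  "status (Suc l) (Lam b) = Pend 0 p \<longleftrightarrow> (\<exists>q \<ge> p. status l b = Free 0 p q)"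
  by (cases "status l b") (auto split: nat.splits)

lemma status_Pend_less: "status l t = Pend j p \<Longrightarrow> j < l"
proof (induction l t arbitrary: j p rule: status.induct)
  case (3 l b)
  then show ?case by (cases j) (auto simp del: status.simps(3))
qed (auto simp del: status.simps(4))

lemma std_Suc: "status l t = Red \<Longrightarrow> std (Suc l) t = std l t"
proof (induction l t rule: status.induct)
  case (4 l f u)
  from 4(3) show ?case by (cases rule: status_App_Red_cases) (use 4 in \<open>auto simp: status_Suc\<close>)
qed (auto simp del: status.simps(3))

text \<open>Only the demanded variable is inspected. The \<open>Free\<close> clause serves the
  induction under a binder, where \<open>up \<sigma>\<close> keeps 0 a variable and a demand for it
  persists.\<close>

lemma status_inst:
  "(\<forall>x p q y. status l t = Free x p q \<longrightarrow> \<sigma> x = Var y \<longrightarrow> status l (inst t \<sigma>) = Free y p q) \<and>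
   ((\<forall>x p q. status l t \<noteq> Free x p q) \<longrightarrow> status l (inst t \<sigma>) = status l t)"
proof (induction l t arbitrary: \<sigma> rule: status.induct)
  case (3 l b)
  show ?case using 3[of "up \<sigma>"] by (cases "status l b") (auto split: nat.splits)
next
  case (4 l f u)
  show ?case
  proof (cases "status (Suc l) f")
    case (Pend j p)
    then show ?thesis using 4(1)[of \<sigma>] 4(2)[OF Pend, of \<sigma>] by (cases j; cases "status 0 u") auto
  qed (use 4(1)[of \<sigma>] in auto)
qed auto

lemma status_inst_nonFree:
  "(\<And>x p q. status l t \<noteq> Free x p q) \<Longrightarrow> status l (inst t \<sigma>) = status l t"
  using status_inst by blast

text \<open>The hypothesis makes the descent end in an abstraction; at a variable, \<sigma> could
  supply a term into which \<open>into\<close> descends further.\<close>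

lemma inst_into:
  "status m u = Ans \<Longrightarrow> inst (into m u b) \<sigma> = into m (inst u \<sigma>) (inst b (up \<sigma>))"
proof (induction m u b arbitrary: \<sigma> rule: into.induct)
  case (2 c b)
  then show ?case by (simp add: inst_subst_0)
next
  case (3 m t b)
  then show ?case by (simp add: inst_lift_1 del: One_nat_def status.simps)
next
  case (4 m t s b)
  then show ?case by (simp del: status.simps)
qed auto

lemma inst_contr:
  "status l f = Pend m p \<Longrightarrow> status 0 u = Ans \<Longrightarrow>
   inst (contr m f u) \<sigma> = contr m (inst f \<sigma>) (inst u \<sigma>)"
proof (induction m f u arbitrary: l \<sigma> rule: contr.induct)
  case (2 b u)
  then show ?case by (simp add: inst_into)
next
  case (3 m b u)
  from 3(2) obtain k where k: "l = Suc k" by (cases l) auto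
  with 3(2) have "status k b = Pend m p" by (simp del: status.simps)
  moreover have "status 0 (lift 1 0 u) = Ans"
    using 3(3) by (simp add: lift_eq_ren ren_eq_inst status_inst_nonFree del: One_nat_def)
  ultimately show ?case using 3(1) by (simp add: inst_lift_0 del: One_nat_def)
next
  case (4 m t s u)
  from 4(2) have "status (Suc l) t = Pend (Suc m) p"
    by (simp del: status.simps)
  then show ?case using 4 by simp
qed auto

lemma std_inst: "status l t = Red \<Longrightarrow> std l (inst t \<sigma>) = inst (std l t) \<sigma>"
proof (induction l t arbitrary: \<sigma> rule: status.induct)
  case (3 l b)
  then show ?case by (simp del: status.simps)
next
  case (4 l f u)
  from 4(3) show ?case
    by (cases rule: status_App_Red_cases) (use 4 in \<open>auto simp: status_inst_nonFree inst_contr\<close>)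
qed auto

section \<open>Standard steps\<close>

definition sstep :: "nat \<Rightarrow> dB \<Rightarrow> dB \<Rightarrow> bool" where
  "sstep l s t \<longleftrightarrow> status l s = Red \<and> t = std l s"

abbreviation ssteps :: "nat \<Rightarrow> dB \<Rightarrow> dB \<Rightarrow> bool" where
  "ssteps l \<equiv> (sstep l)\<^sup>*\<^sup>*"

lemma ssteps_map:
  assumes "ssteps l s t" and "\<And>x y. sstep l x y \<Longrightarrow> sstep k (g x) (g y)"
  shows "ssteps k (g s) (g t)"
  using assms(1) by induction (auto intro: assms(2) rtranclp.rtrancl_into_rtrancl)

lemma ssteps_inst: "ssteps l s t \<Longrightarrow> ssteps l (inst s \<sigma>) (inst t \<sigma>)"
  by (erule ssteps_map) (auto simp: sstep_def std_inst status_inst_nonFree)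

lemma ssteps_Suc: "ssteps l s t \<Longrightarrow> ssteps (Suc l) s t"
  by (erule ssteps_map[where g = "\<lambda>x. x"]) (auto simp: sstep_def std_Suc status_Suc)

lemma ssteps_Lam: "ssteps l s t \<Longrightarrow> ssteps (Suc l) (Lam s) (Lam t)"
  by (erule ssteps_map) (auto simp: sstep_def)

lemma ssteps_App: "ssteps (Suc l) s t \<Longrightarrow> ssteps l (App s u) (App t u)"
  by (erule ssteps_map) (auto simp: sstep_def)

lemma ssteps_arg: "status (Suc l) f = Pend 0 p \<Longrightarrow> ssteps 0 s t \<Longrightarrow> ssteps l (App f s) (App f t)"
  by (erule ssteps_map) (auto simp: sstep_def)

lemma ssteps_not_Red: "ssteps l s t \<Longrightarrow> status l s \<noteq> Red \<Longrightarrow> t = s"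
  by (erule converse_rtranclpE) (auto simp: sstep_def)

text \<open>Determinism: a nonempty sequence begins with the only available step.\<close>

lemma ssteps_Red: "ssteps l s t \<Longrightarrow> status l s = Red \<Longrightarrow> t = s \<or> ssteps l (std l s) t"
  by (erule converse_rtranclpE) (auto simp: sstep_def)

section \<open>Standard reduction sequences\<close>

text \<open>In \<open>stdz_Lam\<close>, truncated subtraction lets the body of an unapplied abstraction start again
  with no pending arguments.\<close>

inductive stdz :: "nat \<Rightarrow> dB \<Rightarrow> dB \<Rightarrow> bool" where
  stdz_Var: "ssteps l s (Var x) \<Longrightarrow> stdz l s (Var x)"
| stdz_Lam: "ssteps l s (Lam b) \<Longrightarrow> stdz (l - 1) b b' \<Longrightarrow> stdz l s (Lam b')"
| stdz_App: "ssteps l s (App f u) \<Longrightarrow> stdz (Suc l) f f' \<Longrightarrow> stdz 0 u u' \<Longrightarrow> stdz l s (App f' u')"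

lemma stdz_refl: "stdz l s s"
  by (induction s arbitrary: l) (blast intro: stdz.intros)+

lemma stdz_LamI: "stdz (l - 1) b b' \<Longrightarrow> stdz l (Lam b) (Lam b')"
  by (blast intro: stdz.intros)

lemma stdz_AppI: "stdz (Suc l) f f' \<Longrightarrow> stdz 0 u u' \<Longrightarrow> stdz l (App f u) (App f' u')"
  by (blast intro: stdz.intros)

lemma ssteps_stdz: "ssteps l s s' \<Longrightarrow> stdz l s' t \<Longrightarrow> stdz l s t"
  by (erule stdz.cases) (auto intro: stdz.intros rtranclp_trans)

section \<open>Weakening, renaming and substitution for \<open>stdz\<close>\<close>

lemma stdz_Suc: "stdz l s t \<Longrightarrow> stdz (Suc l) s t"
proof (induction rule: stdz.induct)
  case (stdz_Lam l s b b')
  \<comment> \<open>For \<open>l = 0\<close> truncation has already placed the body at level 0, as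
    needed here; otherwise the induction hypothesis raises its level.\<close>
  then have "stdz (Suc l - 1) b b'" by (cases l) auto
  with stdz_Lam show ?case by (blast intro: stdz.intros ssteps_Suc)
qed (blast intro: stdz.intros ssteps_Suc)+

lemma stdz_le: "stdz l s t \<Longrightarrow> l \<le> k \<Longrightarrow> stdz k s t"
  by (induction k) (auto simp: le_Suc_eq stdz_Suc)

lemma stdz_inst_Var: "stdz l s t \<Longrightarrow> stdz l (inst s (\<lambda>i. Var (\<xi> i))) (inst t (\<lambda>i. Var (\<xi> i)))"
proof (induction arbitrary: \<xi> rule: stdz.induct)
  case (stdz_Var l s x)
  then show ?case using ssteps_inst[OF stdz_Var, of "\<lambda>i. Var (\<xi> i)"] by (auto intro: stdz.stdz_Var)
next
  case (stdz_Lam l s b b')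
  then show ?case using ssteps_inst[OF stdz_Lam(1), of "\<lambda>i. Var (\<xi> i)"]
    by (auto intro: stdz.stdz_Lam simp: up_Var)
next
  case (stdz_App l s f u f' u')
  then show ?case using ssteps_inst[OF stdz_App(1), of "\<lambda>i. Var (\<xi> i)"]
    by (auto intro: stdz.stdz_App)
qed

lemma stdz_ren: "stdz l s t \<Longrightarrow> stdz l (ren s \<xi>) (ren t \<xi>)"
  unfolding ren_eq_inst by (rule stdz_inst_Var)

lemma stdz_lift: "stdz l s t \<Longrightarrow> stdz l (lift k c s) (lift k c t)"
  unfolding lift_eq_ren by (rule stdz_ren)

text \<open>Level 0 suffices for the substituted terms by \<open>stdz_le\<close>, even where a
  variable has pending arguments.\<close>

lemma stdz_inst:
  "stdz l s t \<Longrightarrow> (\<And>i. stdz 0 (\<sigma> i) (\<tau> i)) \<Longrightarrow> stdz l (inst s \<sigma>) (inst t \<tau>)"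
proof (induction arbitrary: \<sigma> \<tau> rule: stdz.induct)
  case (stdz_Var l s x)
  then have "stdz l (\<sigma> x) (\<tau> x)" by (auto intro: stdz_le)
  then show ?case using ssteps_inst[OF stdz_Var(1), of \<sigma>] by (auto intro: ssteps_stdz)
next
  case (stdz_Lam l s b b')
  have "stdz 0 (up \<sigma> i) (up \<tau> i)" for i
    by (cases i) (auto intro: stdz_refl stdz_ren stdz_Lam.prems)
  then show ?case using stdz_Lam.IH ssteps_inst[OF stdz_Lam(1), of \<sigma>]
    by (auto intro: stdz.stdz_Lam)
next
  case (stdz_App l s f u f' u')
  then show ?case using ssteps_inst[OF stdz_App(1), of \<sigma>] by (auto intro: stdz.stdz_App)
qed

lemma stdz_subst: "stdz l b b' \<Longrightarrow> stdz 0 v v' \<Longrightarrow> stdz l (subst b 0 v) (subst b' 0 v')"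
  unfolding subst_eq_inst by (erule stdz_inst) (auto simp: single_def intro: stdz_refl)

lemma stdz_Var_left: "stdz l (Var x) t \<Longrightarrow> t = Var x"
  by (erule stdz.cases) (auto dest: ssteps_not_Red)

lemma stdz_Lam_left:
  assumes "stdz l (Lam b) t" "status l (Lam b) \<noteq> Red"
  obtains b' where "t = Lam b'" "stdz (l - 1) b b'"
  using assms by (auto elim!: stdz.cases[of l] dest: ssteps_not_Red)

lemma stdz_App_left:
  assumes "stdz l (App f u) t" "status l (App f u) \<noteq> Red"
  obtains f' u' where "t = App f' u'" "stdz (Suc l) f f'" "stdz 0 u u'"
  using assms by (auto elim!: stdz.cases[of l] dest: ssteps_not_Red)

text \<open>An answer has no standard step, so \<open>u'\<close> follows the shape of
  \<open>u\<close>. The body, with \<open>l\<close> pending arguments, replaces a value that had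
  none, which raises the levels from \<open>m\<close> to \<open>m + l\<close>.\<close>

lemma stdz_into:
  "stdz m u u' \<Longrightarrow> status m u = Ans \<Longrightarrow> stdz l b b' \<Longrightarrow> stdz (m + l) (into m u b) (into m u' b')"
proof (induction m u b arbitrary: u' b' rule: into.induct)
  case (2 c b)
  then obtain c' where "u' = Lam c'" by (auto elim: stdz_Lam_left)
  then show ?case using 2 by (auto intro: stdz_subst)
next
  case (3 m t b)
  then obtain t' where "u' = Lam t'" "stdz m t t'" by (auto elim: stdz_Lam_left)
  moreover have "status m t = Ans" using 3(3) by (simp del: status.simps)
  ultimately show ?case using 3(1)[OF _ _ stdz_lift[OF 3(4)]] by (auto intro: stdz_LamI)
next
  case (4 m t s b)
  then obtain t' s' where "u' = App t' s'" "stdz (Suc m) t t'" "stdz 0 s s'"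
    by (auto elim: stdz_App_left)
  moreover have "status (Suc m) t = Ans" using 4(3) by (simp del: status.simps)
  ultimately show ?case using 4 by (auto intro: stdz_AppI)
qed auto

lemma stdz_contr:
  "stdz (Suc l) f f' \<Longrightarrow> status (Suc l) f = Pend m p \<Longrightarrow> stdz 0 u u' \<Longrightarrow> status 0 u = Ans \<Longrightarrow>
   stdz l (contr m f u) (contr m f' u')"
proof (induction m f u arbitrary: l f' u' rule: contr.induct)
  case (2 b u)
  then obtain b' where "f' = Lam b'" "stdz l b b'" by (auto elim: stdz_Lam_left)
  then show ?case using stdz_into[OF 2(3) 2(4), of l] by simp
next
  case (3 m b u)
  then obtain b' where b': "f' = Lam b'" "stdz l b b'" by (auto elim: stdz_Lam_left)
  have *: "status l b = Pend m p" using 3(3) by (simp del: status.simps)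
  \<comment> \<open>Only existing arguments are demanded, so \<open>m < l\<close> and no truncation
    occurs.\<close>
  then obtain k where k: "l = Suc k" using status_Pend_less by (cases l) auto
  have "status 0 (lift 1 0 u) = Ans"
    using 3(5) by (simp add: lift_eq_ren ren_eq_inst status_inst_nonFree del: One_nat_def)
  then have "stdz k (contr m b (lift 1 0 u)) (contr m b' (lift 1 0 u'))"
    using 3(1)[OF _ _ stdz_lift[OF 3(4)], of k b'] b' * k by simp
  then show ?case using b' k by (auto intro: stdz_LamI)
next
  case (4 m t s u)
  then obtain t' s' where "f' = App t' s'" "stdz (Suc (Suc l)) t t'" "stdz 0 s s'"
    by (auto elim: stdz_App_left)
  moreover have "status (Suc (Suc l)) t = Pend (Suc m) p"
    using 4(3) by (simp del: status.simps)
  ultimately show ?case using 4 by (auto intro: stdz_AppI)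
qed auto

text \<open>No standard step is available along the demanded path, so both terms agree there; they
  differ only where the head does not look.\<close>

lemma stdz_status: "stdz l s t \<Longrightarrow> status l s \<noteq> Red \<Longrightarrow> status l t = status l s"
proof (induction l s arbitrary: t rule: status.induct)
  case (1 l x)
  then show ?case by (auto dest: stdz_Var_left)
next
  case (2 b)
  then show ?case by (auto elim: stdz_Lam_left)
next
  case (3 l b)
  then obtain b' where "t = Lam b'" "stdz l b b'" by (auto elim: stdz_Lam_left)
  moreover have "status l b \<noteq> Red" using 3(3) by (simp del: status.simps)
  ultimately show ?case using 3(1) by simp
next
  case (4 l f u)
  then obtain f' u' where t: "t = App f' u'" "stdz (Suc l) f f'" "stdz 0 u u'"
    by (auto elim: stdz_App_left)
  have f: "status (Suc l) f \<noteq> Red" using 4(4) by auto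
  then have f': "status (Suc l) f' = status (Suc l) f" using 4(1) t by blast
  show ?case
  proof (cases "\<exists>p. status (Suc l) f = Pend 0 p")
    case True
    then obtain p where p: "status (Suc l) f = Pend 0 p" by blast
    then have "status 0 u \<noteq> Red" using 4(4) by auto
    then have "status 0 u' = status 0 u" using 4(2)[OF p refl] t by blast
    then show ?thesis using f' t p by simp
  next
    case False
    then show ?thesis using f' t by (cases "status (Suc l) f") (auto split: nat.splits)
  qed
qed

text \<open>If an initial sequence on the way to the redex is nonempty, it starts with this step,
  and dropping it gives the first alternative. Otherwise the redex survives in \<open>t\<close>, and
  \<open>stdz_contr\<close> relates the contracta.\<close>

lemma stdz_diamond:
  "stdz l s t \<Longrightarrow> status l s = Red \<Longrightarrow>
   stdz l (std l s) t \<or> status l t = Red \<and> stdz l (std l s) (std l t)"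
proof (induction rule: stdz.induct)
  case (stdz_Var l s x)
  then have "Var x \<noteq> s" by auto
  then show ?case using ssteps_Red[OF stdz_Var] stdz.stdz_Var by blast
next
  case (stdz_Lam l s b b')
  from ssteps_Red[OF stdz_Lam(1,4)] show ?case
  proof
    assume s: "Lam b = s"
    with stdz_Lam(4) obtain k where k: "l = Suc k" by (cases l) auto
    then have "status k b = Red" using stdz_Lam(4) unfolding s[symmetric] by (simp del: status.simps)
    then have "stdz k (std k b) b' \<or> status k b' = Red \<and> stdz k (std k b) (std k b')"
      using stdz_Lam(3) k by simp
    then have "stdz l (Lam (std k b)) (Lam b') \<or>
        status l (Lam b') = Red \<and> stdz l (Lam (std k b)) (Lam (std k b'))"
      using k stdz_LamI[of l] by (auto simp del: status.simps)
    then show ?thesis unfolding s[symmetric] k by simp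
  next
    assume "ssteps l (std l s) (Lam b)"
    then show ?thesis using stdz_Lam(2) by (blast intro: stdz.stdz_Lam)
  qed
next
  case (stdz_App l s f u f' u')
  from ssteps_Red[OF stdz_App(1,6)] show ?case
  proof
    assume s: "App f u = s"
    from stdz_App(6) have "status l (App f u) = Red" unfolding s .
    then show ?thesis
    proof (cases rule: status_App_Red_cases)
      case func
      then have std: "std l s = App (std (Suc l) f) u" unfolding s[symmetric] by simp
      from stdz_App(4)[OF func] show ?thesis
      proof
        assume "stdz (Suc l) (std (Suc l) f) f'"
        then show ?thesis unfolding std using stdz_App(3) by (blast intro: stdz_AppI)
      next
        assume *: "status (Suc l) f' = Red \<and> stdz (Suc l) (std (Suc l) f) (std (Suc l) f')"
        then have "status l (App f' u') = Red" "std l (App f' u') = App (std (Suc l) f') u'"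
          by simp_all
        then show ?thesis unfolding std using stdz_App(3) * by (metis stdz_AppI)
      qed
    next
      case (redex p)
      then have "status (Suc l) f' = Pend 0 p" "status 0 u' = Ans"
        using stdz_status[OF stdz_App(2)] stdz_status[OF stdz_App(3)] by simp_all
      then have "status l (App f' u') = Red" "std l (App f' u') = contr 0 f' u'" by simp_all
      moreover have "std l s = contr 0 f u" unfolding s[symmetric] using redex by simp
      ultimately show ?thesis using stdz_contr[OF stdz_App(2) redex(1) stdz_App(3) redex(2)]
        by simp
    next
      case (arg p)
      then have std: "std l s = App f (std 0 u)" unfolding s[symmetric] by simp
      have f': "status (Suc l) f' = Pend 0 p" using stdz_status[OF stdz_App(2)] arg by simp
      from stdz_App(5)[OF arg(2)] show ?thesis
      proof
        assume "stdz 0 (std 0 u) u'"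
        then show ?thesis unfolding std using stdz_App(2) by (blast intro: stdz_AppI)
      next
        assume *: "status 0 u' = Red \<and> stdz 0 (std 0 u) (std 0 u')"
        then have "status l (App f' u') = Red" "std l (App f' u') = App f' (std 0 u')"
          using f' by simp_all
        then show ?thesis unfolding std using stdz_App(2) * by (metis stdz_AppI)
      qed
    qed
  next
    assume "ssteps l (std l s) (App f u)"
    then show ?thesis using stdz_App(2,3) by (blast intro: stdz.stdz_App)
  qed
qed

text \<open>Initial steps come first, then those of the function, then those of the argument if it
  is demanded; nothing else affects the head.\<close>

lemma stdz_reach_status:
  "stdz l s t \<Longrightarrow> status l t \<noteq> Red \<Longrightarrow> \<exists>s'. ssteps l s s' \<and> stdz l s' t \<and> status l s' = status l t"
proof (induction rule: stdz.induct)
  case (stdz_Var l s x)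
  then show ?case by (blast intro: stdz_refl)
next
  case (stdz_Lam l s b b')
  show ?case
  proof (cases l)
    case 0
    then have "stdz l (Lam b) (Lam b')" "status l (Lam b) = status l (Lam b')"
      using stdz_Lam(2) by (auto intro: stdz_LamI)
    then show ?thesis using stdz_Lam(1) by blast
  next
    case (Suc k)
    then have "status k b' \<noteq> Red" using stdz_Lam(4) by (simp del: status.simps)
    then obtain b'' where b'': "ssteps k b b''" "stdz k b'' b'" "status k b'' = status k b'"
      using stdz_Lam(3) Suc by auto
    have "ssteps l s (Lam b'')"
      using stdz_Lam(1) ssteps_Lam[OF b''(1)] unfolding Suc by (rule rtranclp_trans)
    moreover have "stdz l (Lam b'') (Lam b')" using b'' Suc by (simp add: stdz_LamI)
    moreover have "status l (Lam b'') = status l (Lam b')" using b'' Suc by simp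
    ultimately show ?thesis by blast
  qed
next
  case (stdz_App l s f u f' u')
  have "status (Suc l) f' \<noteq> Red" using stdz_App(6) by auto
  then obtain g where g: "ssteps (Suc l) f g" "stdz (Suc l) g f'" "status (Suc l) g = status (Suc l) f'"
    using stdz_App(4) by blast
  have sg: "ssteps l s (App g u)" using stdz_App(1) ssteps_App[OF g(1)] by (rule rtranclp_trans)
  show ?case
  proof (cases "\<exists>p. status (Suc l) f' = Pend 0 p")
    case True
    then obtain p where p: "status (Suc l) f' = Pend 0 p" by blast
    then have "status 0 u' \<noteq> Red" using stdz_App(6) by auto
    then obtain w where w: "ssteps 0 u w" "stdz 0 w u'" "status 0 w = status 0 u'"
      using stdz_App(5) by blast
    have "ssteps l s (App g w)"
      using sg ssteps_arg[OF _ w(1)] g(3) p by (metis rtranclp_trans)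
    moreover have "status l (App g w) = status l (App f' u')" using g(3) w(3) p by simp
    ultimately show ?thesis using g w by (blast intro: stdz_AppI)
  next
    case False
    then have "status l (App g u) = status l (App f' u')"
      using g(3) by (cases "status (Suc l) f'") (auto split: nat.splits)
    then show ?thesis using sg g stdz_App(3) by (blast intro: stdz_AppI)
  qed
qed

text \<open>To fire a redex of the target, function and argument of the source are driven by
  \<open>stdz_reach_status\<close> until the same redex appears there.\<close>

lemma stdz_std: "stdz l s t \<Longrightarrow> status l t = Red \<Longrightarrow> stdz l s (std l t)"
proof (induction rule: stdz.induct)
  case (stdz_Var l s x)
  then show ?case by simp
next
  case (stdz_Lam l s b b')
  then obtain k where k: "l = Suc k" by (cases l) auto
  then have "status k b' = Red" using stdz_Lam(4) by (simp del: status.simps)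
  then have "stdz (l - 1) b (std k b')" using stdz_Lam(3) k by simp
  then show ?case using stdz.stdz_Lam[OF stdz_Lam(1)] k by simp
next
  case (stdz_App l s f u f' u')
  from stdz_App(6) show ?case
  proof (cases rule: status_App_Red_cases)
    case func
    then show ?thesis using stdz.stdz_App[OF stdz_App(1) stdz_App(4)[OF func] stdz_App(3)] by simp
  next
    case (redex p)
    obtain g where g: "ssteps (Suc l) f g" "stdz (Suc l) g f'" "status (Suc l) g = Pend 0 p"
      using stdz_reach_status[OF stdz_App(2)] redex by auto
    obtain w where w: "ssteps 0 u w" "stdz 0 w u'" "status 0 w = Ans"
      using stdz_reach_status[OF stdz_App(3)] redex by auto
    have "sstep l (App g w) (contr 0 g w)" using g w by (simp add: sstep_def)
    then have "ssteps l s (contr 0 g w)"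
      using stdz_App(1) ssteps_App[OF g(1), of u] ssteps_arg[OF g(3) w(1)]
      by (meson rtranclp.rtrancl_into_rtrancl rtranclp_trans)
    moreover have "stdz l (contr 0 g w) (contr 0 f' u')"
      using stdz_contr g w by blast
    ultimately show ?thesis using redex by (auto intro: ssteps_stdz)
  next
    case (arg p)
    then show ?thesis using stdz.stdz_App[OF stdz_App(1,2) stdz_App(5)[OF arg(2)]] by simp
  qed
qed

section \<open>Invariance of termination\<close>

definition halts :: "dB \<Rightarrow> bool" where
  "halts s \<longleftrightarrow> (\<exists>a. ssteps 0 s a \<and> status 0 a = Ans)"

text \<open>By \<open>stdz_diamond\<close> each step of \<open>s\<close> is either absorbed or
  matched by one step of \<open>t\<close>; at the end \<open>stdz_status\<close> makes the target an
  answer.\<close>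

lemma stdz_halts_forward:
  assumes "ssteps 0 s a" "status 0 a = Ans" "stdz 0 s t"
  shows "halts t"
  using assms
proof (induction arbitrary: t rule: converse_rtranclp_induct)
  case base
  then show ?case using stdz_status[of 0 a t] by (auto simp: halts_def)
next
  case (step s s')
  from stdz_diamond[OF step(5)] step(1)
  have "stdz 0 s' t \<or> status 0 t = Red \<and> stdz 0 s' (std 0 t)" by (auto simp: sstep_def)
  then show ?case
  proof
    assume "stdz 0 s' t"
    then show ?thesis using step by blast
  next
    assume *: "status 0 t = Red \<and> stdz 0 s' (std 0 t)"
    then have "halts (std 0 t)" using step by blast
    moreover have "sstep 0 t (std 0 t)" using * by (simp add: sstep_def)
    ultimately show ?thesis by (auto simp: halts_def intro: converse_rtranclp_into_rtranclp)
  qed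
qed

lemma stdz_halts_backward:
  assumes "ssteps 0 t a" "status 0 a = Ans" "stdz 0 s t"
  shows "halts s"
proof -
  from assms(1,3) have "stdz 0 s a"
    by (induction rule: rtranclp_induct) (auto simp: sstep_def stdz_std)
  then show ?thesis using stdz_reach_status[of 0 s a] assms(2) by (auto simp: halts_def)
qed

lemma stdz_halts_iff: "stdz 0 s t \<Longrightarrow> halts s \<longleftrightarrow> halts t"
  using stdz_halts_forward stdz_halts_backward unfolding halts_def by blast

section \<open>Pure paths in contexts\<close>

lemma plug_cplug [simp]: "plug (cplug C D) t = plug C (plug D t)"
  by (induction C) auto

lemma depth_cplug [simp]: "depth (cplug C D) = depth C + depth D"
  by (induction C) auto

lemma cplug_assoc [simp]: "cplug (cplug C D) F = cplug C (cplug D F)"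
  by (induction C) auto

lemma cplug_Hole [simp]: "cplug C Hole = C"
  by (induction C) auto

lemma ans_ctx_cplug: "ans_ctx A \<Longrightarrow> ans_ctx B \<Longrightarrow> ans_ctx (cplug A B)"
  by (induction rule: ans_ctx.induct) (auto intro: ans_ctx.intros)

text \<open>The index counts surplus applications, in \<open>inner_k\<close> surplus abstractions;
  equality of the two expresses that the composed context is an answer context.\<close>

inductive outer_k :: "nat \<Rightarrow> ctx \<Rightarrow> bool" where
  "outer_k 0 Hole"
| "ans_ctx A \<Longrightarrow> outer_k k Au \<Longrightarrow> outer_k (Suc k) (CAppL (cplug A Au) e)"

inductive inner_k :: "nat \<Rightarrow> ctx \<Rightarrow> bool" where
  "inner_k 0 Hole"
| "ans_ctx A \<Longrightarrow> inner_k k Ad \<Longrightarrow> inner_k (Suc k) (cplug A (CLam Ad))"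

inductive_cases outer_k_0E: "outer_k 0 C"
inductive_cases outer_k_SucE: "outer_k (Suc k) C"
inductive_cases inner_k_0E: "inner_k 0 C"
inductive_cases inner_k_SucE: "inner_k (Suc k) C"

lemma outer_k_imp_outer_ctx: "outer_k k C \<Longrightarrow> outer_ctx C"
  by (induction rule: outer_k.induct) (auto intro: outer_ctx.intros)

lemma outer_ctx_imp_outer_k: "outer_ctx C \<Longrightarrow> \<exists>k. outer_k k C"
  by (induction rule: outer_ctx.induct) (auto intro: outer_k.intros)

lemma inner_k_imp_inner_ctx: "inner_k k C \<Longrightarrow> inner_ctx C"
  by (induction rule: inner_k.induct) (auto intro: inner_ctx.intros)

lemma inner_ctx_imp_inner_k: "inner_ctx C \<Longrightarrow> \<exists>k. inner_k k C"
  by (induction rule: inner_ctx.induct) (auto intro: inner_k.intros)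

text \<open>A counting invariant, additive under composition and zero on answer contexts, which
  forces matching outer and inner counts.\<close>

fun balance :: "ctx \<Rightarrow> int" where
  "balance Hole = 0"
| "balance (CLam C) = balance C - 1"
| "balance (CAppL C u) = balance C + 1"
| "balance (CAppR u C) = balance C"

lemma balance_cplug [simp]: "balance (cplug C D) = balance C + balance D"
  by (induction C) auto

lemma balance_ans_ctx: "ans_ctx A \<Longrightarrow> balance A = 0"
  by (induction rule: ans_ctx.induct) auto

lemma balance_outer_k: "outer_k k C \<Longrightarrow> balance C = int k"
  by (induction rule: outer_k.induct) (auto simp: balance_ans_ctx)

lemma balance_inner_k: "inner_k k C \<Longrightarrow> balance C = - int k"
  by (induction rule: inner_k.induct) (auto simp: balance_ans_ctx)

lemma outer_inner_match:
  assumes "outer_ctx Au" "inner_ctx Ad" "ans_ctx (cplug Au Ad)"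
  obtains k where "outer_k k Au" "inner_k k Ad"
proof -
  obtain k where k: "outer_k k Au" using outer_ctx_imp_outer_k assms(1) by blast
  obtain j where j: "inner_k j Ad" using inner_ctx_imp_inner_k assms(2) by blast
  have "k = j" using balance_outer_k[OF k] balance_inner_k[OF j] balance_ans_ctx[OF assms(3)] by simp
  then show ?thesis using that k j by blast
qed

text \<open>A path l C m p leads from l to m pending arguments through function positions and
  abstractions only, and p is the least number on the way.\<close>

inductive path :: "nat \<Rightarrow> ctx \<Rightarrow> nat \<Rightarrow> nat \<Rightarrow> bool" where
  path_Hole: "path l Hole l l"
| path_CAppL: "path (Suc l) C m p \<Longrightarrow> path l (CAppL C u) m (min l p)"
| path_CLam: "path l C m p \<Longrightarrow> path (Suc l) (CLam C) m p"

lemma path_min_le: "path l C m p \<Longrightarrow> p \<le> l \<and> p \<le> m"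
  by (induction rule: path.induct) auto

lemma path_cplug: "path l C m p \<Longrightarrow> path m D n q \<Longrightarrow> path l (cplug C D) n (min p q)"
proof (induction rule: path.induct)
  case (path_Hole l)
  then have "min l q = q" using path_min_le by fastforce
  then show ?case using path_Hole by simp
next
  case (path_CAppL l C m p u)
  then have "path l (CAppL (cplug C D) u) n (min l (min p q))" by (blast intro: path.path_CAppL)
  then show ?case by (simp add: min.assoc)
qed (auto intro: path.intros)

text \<open>Each abstraction consumes an argument supplied by the context itself, so the count never
  drops below \<open>l\<close>. Outer contexts have their minimum at the start, inner ones at the
  end.\<close>

lemma ans_ctx_path: "ans_ctx A \<Longrightarrow> path l A l l"
proof (induction arbitrary: l rule: ans_ctx.induct)
  case (2 A1 A2 e)
  have "path (Suc l) (cplug A1 (CLam A2)) l (min (Suc l) l)"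
    using 2 by (blast intro: path_cplug path_CLam)
  then show ?case using path_CAppL[of l "cplug A1 (CLam A2)" l l e] by simp
qed (rule path.intros)

lemma outer_k_path: "outer_k k C \<Longrightarrow> path l C (l + k) l"
proof (induction arbitrary: l rule: outer_k.induct)
  case (1)
  show ?case using path_Hole by simp
next
  case (2 A k Au e)
  have "path (Suc l) (cplug A Au) (Suc l + k) (min (Suc l) (Suc l))"
    using 2 by (blast intro: path_cplug ans_ctx_path)
  then show ?case using path_CAppL[of l "cplug A Au" "Suc l + k" "Suc l" e] by simp
qed

lemma inner_k_path: "inner_k k C \<Longrightarrow> path (l + k) C l l"
proof (induction arbitrary: l rule: inner_k.induct)
  case (1)
  show ?case using path_Hole by simp
next
  case (2 A k Ad)
  have "path (Suc (l + k)) (cplug A (CLam Ad)) l (min (Suc (l + k)) l)"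
    using 2 by (blast intro: path_cplug ans_ctx_path path_CLam)
  then show ?case by (simp add: min_def)
qed

lemma inner_k_ans_ctx: "inner_k (Suc k) C \<Longrightarrow> ans_ctx A \<Longrightarrow> inner_k (Suc k) (cplug A C)"
proof (erule inner_k_SucE)
  fix B Ad assume "ans_ctx A" "C = cplug B (CLam Ad)" "ans_ctx B" "inner_k k Ad"
  then show "inner_k (Suc k) (cplug A C)"
    using inner_k.intros(2)[of "cplug A B" k Ad] ans_ctx_cplug by simp
qed

text \<open>The path is cut at its first and last visit to the minimum \<open>p\<close>: before the
  first it loses \<open>l - p\<close> arguments, after the last it gains \<open>m - p\<close>, and
  the piece between is balanced.\<close>

lemma path_decompose:
  "path l C m p \<Longrightarrow> \<exists>Ad A Au. C = cplug Ad (cplug A Au) \<and> inner_k (l - p) Ad \<and> ans_ctx A \<and> outer_k (m - p) Au"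
proof (induction rule: path.induct)
  case (path_Hole l)
  then show ?case by (auto intro!: exI[of _ Hole] intro: inner_k.intros ans_ctx.intros outer_k.intros)
next
  case (path_CAppL l C m p u)
  then obtain Ad A Au where C: "C = cplug Ad (cplug A Au)" and Ad: "inner_k (Suc l - p) Ad"
    and A: "ans_ctx A" and Au: "outer_k (m - p) Au" by blast
  have p: "p \<le> Suc l" "p \<le> m" using path_min_le[OF path_CAppL(1)] by auto
  show ?case
  proof (cases "p = Suc l")
    case True
    then have "Ad = Hole" using Ad by (auto elim: inner_k_0E)
    moreover have "outer_k (Suc (m - p)) (CAppL (cplug A Au) u)" using A Au by (rule outer_k.intros)
    moreover have "m - min l p = Suc (m - p)" using True p by auto
    ultimately show ?thesis using C True
      by (intro exI[of _ Hole] exI[of _ "CAppL (cplug A Au) u"])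
        (auto intro: inner_k.intros ans_ctx.intros)
  next
    case False
    then have *: "Suc l - p = Suc (l - p)" "min l p = p" using p by auto
    then obtain B Ad' where B: "Ad = cplug B (CLam Ad')" "ans_ctx B" "inner_k (l - p) Ad'"
      using Ad by (auto elim: inner_k_SucE)
    \<comment> \<open>The new application and the abstraction that consumes it form an answer
      context. It joins the inner part, or the balanced part if the inner one is empty.\<close>
    define A' where "A' = CAppL (cplug B (CLam Hole)) u"
    have A': "ans_ctx A'" unfolding A'_def using B by (blast intro: ans_ctx.intros)
    have eq: "CAppL C u = cplug A' (cplug Ad' (cplug A Au))" unfolding A'_def C B by simp
    show ?thesis
    proof (cases "l - p")
      case 0
      then have "Ad' = Hole" using B by (auto elim: inner_k_0E)
      then have "CAppL C u = cplug Hole (cplug (cplug A' A) Au)" using eq by simp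
      moreover have "inner_k (l - min l p) Hole" using 0 * inner_k.intros(1) by simp
      moreover have "outer_k (m - min l p) Au" using * Au by simp
      ultimately show ?thesis using ans_ctx_cplug[OF A' A] by blast
    next
      case (Suc k)
      then have "inner_k (l - min l p) (cplug A' Ad')" using inner_k_ans_ctx A' B(3) * by simp
      moreover have "CAppL C u = cplug (cplug A' Ad') (cplug A Au)" using eq by simp
      moreover have "outer_k (m - min l p) Au" using * Au by simp
      ultimately show ?thesis using A by blast
    qed
  qed
next
  case (path_CLam l C m p)
  then obtain Ad A Au where C: "C = cplug Ad (cplug A Au)" and Ad: "inner_k (l - p) Ad"
    and A: "ans_ctx A" and Au: "outer_k (m - p) Au" by blast
  have "Suc l - p = Suc (l - p)" using path_min_le[OF path_CLam(1)] by auto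
  then have "inner_k (Suc l - p) (CLam Ad)"
    using inner_k.intros(2)[OF ans_ctx.intros(1) Ad] by simp
  moreover have "CLam C = cplug (CLam Ad) (cplug A Au)" using C by simp
  ultimately show ?case using A Au by blast
qed

lemma path_0_decompose:
  assumes "path 0 C m p"
  obtains A Au where "C = cplug A Au" "ans_ctx A" "outer_k m Au"
proof -
  have "p = 0" using path_min_le[OF assms] by simp
  then obtain Ad A Au where "C = cplug Ad (cplug A Au)" "inner_k 0 Ad" "ans_ctx A" "outer_k m Au"
    using path_decompose[OF assms] by auto
  then show ?thesis using that by (auto elim: inner_k_0E)
qed

lemma path_0_ans_ctx: "path 0 C 0 p \<Longrightarrow> ans_ctx C"
  by (erule path_0_decompose) (auto elim: outer_k_0E)

lemma ans_ctx_outer_inner: "outer_k k Au \<Longrightarrow> inner_k k Ad \<Longrightarrow> ans_ctx (cplug Au Ad)"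
  using path_cplug[OF outer_k_path[of k Au 0] inner_k_path[of k Ad 0]] path_0_ans_ctx by simp

lemma path_status_Free:
  "path l C m p \<Longrightarrow> status m t = Free (x + depth C) a b \<Longrightarrow> a \<le> m \<Longrightarrow>
   status l (plug C t) = Free x (min p a) b"
proof (induction arbitrary: x rule: path.induct)
  case (path_CAppL l C m p u)
  then show ?case by (simp add: min.assoc)
qed auto

text \<open>The pending arguments form a stack, and the demanded one has position
  \<open>m - j - 1\<close> from the bottom. As \<open>m \<le> p + j\<close>, the path never removes
  it, so it comes from outside, where its index from the top is \<open>j + l - m\<close>.\<close>

lemma path_status_Pend:
  "path l C m p \<Longrightarrow> status m t = Pend j a \<Longrightarrow> m \<le> p + j \<Longrightarrow>
   status l (plug C t) = Pend (j + l - m) a"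
proof (induction rule: path.induct)
  case (path_CAppL l C m p u)
  have "m \<le> p + j" "j + Suc l - m = Suc (j + l - m)" using path_CAppL(4) by (auto simp: min_def split: if_splits)
  then show ?case using path_CAppL by simp
next
  case (path_CLam l C m p)
  have "j + Suc l - m = Suc (j + l - m)" using path_CLam path_min_le[OF path_CLam(1)] by auto
  then show ?case using path_CLam by simp
qed auto

lemma path_status_Ans: "path l C m p \<Longrightarrow> status m t = Ans \<Longrightarrow> status l (plug C t) = Ans"
  by (induction rule: path.induct) auto

lemma path_stdz: "path l C m p \<Longrightarrow> stdz m s t \<Longrightarrow> stdz l (plug C s) (plug C t)"
  by (induction rule: path.induct) (auto intro: stdz_AppI stdz_LamI stdz_refl)

lemma status_Ans_path:
  "status l t = Ans \<Longrightarrow> \<exists>C b p. path l C 0 p \<and> t = plug C (Lam b)"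
proof (induction l t rule: status.induct)
  case (2 b)
  show ?case using path_Hole by (intro exI[of _ Hole]) auto
next
  case (3 l b)
  then have "status l b = Ans" by (simp del: status.simps)
  then obtain C b' p where "path l C 0 p" "b = plug C (Lam b')" using 3(1) by blast
  then show ?case using path_CLam[of l C 0 p] by (intro exI[of _ "CLam C"]) auto
next
  case (4 l f u)
  then have "status (Suc l) f = Ans" by (simp del: status.simps)
  then obtain C b' p where "path (Suc l) C 0 p" "f = plug C (Lam b')" using 4(1) by blast
  then show ?case using path_CAppL[of l C 0 p u] by (intro exI[of _ "CAppL C u"]) auto
qed simp

lemma is_answer_iff_status: "is_answer t \<longleftrightarrow> status 0 t = Ans"
proof
  assume "is_answer t"
  then show "status 0 t = Ans"
    using path_status_Ans[OF ans_ctx_path, of _ 0] unfolding is_answer_def is_value_def by fastforce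
next
  assume "status 0 t = Ans"
  then show "is_answer t"
    using status_Ans_path path_0_ans_ctx unfolding is_answer_def is_value_def by blast
qed

section \<open>Need steps are standard reduction sequences\<close>

lemma contr_plug: "ans_ctx A \<Longrightarrow> contr m (plug A t) u = plug A (contr m t (lift (depth A) 0 u))"
proof (induction arbitrary: m t u rule: ans_ctx.induct)
  case (2 A1 A2 e)
  then show ?case by (simp add: lift_lift_0 add.commute)
qed simp

lemma into_plug: "ans_ctx A \<Longrightarrow> into m (plug A t) b = plug A (into m t (lift (depth A) 1 b))"
proof (induction arbitrary: m t b rule: ans_ctx.induct)
  case (2 A1 A2 e)
  then show ?case by (simp add: lift_lift_1[unfolded One_nat_def] add.commute)
qed simp

lemma lift_plug: "lift k c (plug C t) = plug (lift_ctx k c C) (lift k (c + depth C) t)"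
  by (induction C arbitrary: c) auto

lemma lift_ctx_cplug: "lift_ctx k c (cplug C D) = cplug (lift_ctx k c C) (lift_ctx k (c + depth C) D)"
  by (induction C arbitrary: c) auto

lemma depth_lift_ctx [simp]: "depth (lift_ctx k c C) = depth C"
  by (induction C arbitrary: c) auto

lemma ans_ctx_lift_ctx: "ans_ctx A \<Longrightarrow> ans_ctx (lift_ctx k c A)"
  by (induction arbitrary: c rule: ans_ctx.induct) (auto simp: lift_ctx_cplug intro: ans_ctx.intros)

text \<open>Ties the recursive \<open>contr\<close> to the axiom: passing \<open>A1\<close> lifts
  the argument, and passing \<open>A2\<close> lifts the body above its bound variable.\<close>

lemma contr_redex:
  assumes "ans_ctx A1" "ans_ctx A2" "is_value v"
  shows "contr 0 (plug A1 (Lam b)) (plug A2 v) =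
    plug A1 (plug (lift_ctx (depth A1) 0 A2)
      (subst (lift (depth A2) 1 b) 0 (lift (depth A1) (depth A2) v)))"
proof -
  obtain c where "v = Lam c" using assms(3) by (auto simp: is_value_def)
  then show ?thesis using assms
    by (simp add: contr_plug lift_plug into_plug ans_ctx_lift_ctx del: One_nat_def)
qed

lemma status_demand:
  assumes "inner_k k Ad" "ans_ctx A" "status l (plug E (Var (depth Ad + depth E))) = Free (depth Ad) l q"
    and "l \<le> q"
  shows "status (Suc (l + k)) (plug A (Lam (plug Ad (plug E (Var (depth Ad + depth E)))))) = Pend 0 l"
proof -
  have "status (l + k) (plug Ad (plug E (Var (depth Ad + depth E)))) = Free 0 l q"
    using path_status_Free[OF inner_k_path[OF assms(1), of l], where x = 0] assms(3) by simp
  then have "status (Suc (l + k)) (Lam (plug Ad (plug E (Var (depth Ad + depth E))))) = Pend 0 l"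
    using assms(4) by simp
  then show ?thesis using path_status_Pend[OF ans_ctx_path[OF assms(2), of "Suc (l + k)"]] by simp
qed

text \<open>An evaluation context never uses up an argument from outside, hence the minimum
  \<open>l\<close>; the bound on \<open>q\<close> lets an enclosing abstraction bind the variable
  without becoming \<open>Bad\<close>.\<close>

lemma status_eval_ctx:
  "eval_ctx E \<Longrightarrow> \<exists>q \<ge> l. status l (plug E (Var (x + depth E))) = Free x l q"
proof (induction arbitrary: l x rule: eval_ctx.induct)
  case 1
  then show ?case by simp
next
  case (2 E e)
  obtain q where "q \<ge> Suc l" "status (Suc l) (plug E (Var (x + depth E))) = Free x (Suc l) q"
    using 2(2) by blast
  then show ?case by auto
next
  case (3 A E)
  obtain q where "q \<ge> l" "status l (plug E (Var (x + depth A + depth E))) = Free (x + depth A) l q"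
    using 3(3) by blast
  then show ?case using path_status_Free[OF ans_ctx_path[OF 3(1), of l], of _ x l q]
    by (simp add: add.assoc)
next
  case (4 Au A Ad E1 E2)
  obtain k where k: "outer_k k Au" "inner_k k Ad" by (rule outer_inner_match[OF "4.hyps"(1,3,6)])
  obtain q where q: "q \<ge> l" "status l (plug E1 (Var (depth Ad + depth E1))) = Free (depth Ad) l q"
    using "4.IH"(1) by blast
  obtain q2 where q2: "status 0 (plug E2 (Var (x + depth Au + depth E2))) = Free (x + depth Au) 0 q2"
    using "4.IH"(2) by blast
  \<comment> \<open>\<open>Au\<close> has raised the count to \<open>l + k\<close> and
    \<open>Ad\<close> takes it back to \<open>l\<close>, so the minimum inside the function is
    \<open>l\<close>.\<close>
  have "status (l + k) (App (plug A (Lam (plug Ad (plug E1 (Var (depth Ad + depth E1))))))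
      (plug E2 (Var (x + depth Au + depth E2)))) = Free (x + depth Au) (l + k) l"
    using status_demand[OF k(2) "4.hyps"(2) q(2,1)] q2 by simp
  from path_status_Free[OF outer_k_path[OF k(1), of l] this]
  show ?case by (simp add: add.assoc)
qed

text \<open>Below \<open>Au\<close> there are \<open>k\<close> pending arguments, and with these the
  contraction is a single standard step; \<open>Au\<close> itself is related by reflexivity.\<close>

lemma beta_need_stdz:
  assumes "beta_need s t"
  shows "stdz 0 s t"
  using assms
proof cases
  case (1 Au A1 Ad E A2 v body)
  obtain k where k: "outer_k k Au" "inner_k k Ad" by (rule outer_inner_match[OF 1(3,5,9)])
  obtain q where q: "q \<ge> 0" "status 0 (plug E (Var (depth Ad + depth E))) = Free (depth Ad) 0 q"
    using status_eval_ctx[OF 1(6), of 0 "depth Ad"] by blast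
  let ?f = "plug A1 (Lam body)" and ?u = "plug A2 v"
  have f: "status (Suc k) ?f = Pend 0 0" using status_demand[OF k(2) 1(4) q(2,1)] 1(10) by simp
  have "is_answer ?u" using 1(7,8) unfolding is_answer_def by blast
  then have u: "status 0 ?u = Ans" by (simp only: is_answer_iff_status)
  have "sstep k (App ?f ?u) (contr 0 ?f ?u)" using f u by (simp add: sstep_def)
  then have "stdz k (App ?f ?u) (contr 0 ?f ?u)" by (blast intro: ssteps_stdz stdz_refl)
  then have "stdz 0 (plug Au (App ?f ?u)) (plug Au (contr 0 ?f ?u))"
    using path_stdz[OF outer_k_path[OF k(1), of 0]] by simp
  then show ?thesis unfolding 1(1,2) contr_redex[OF 1(4,7,8)] .
qed

lemma need_step_stdz: "need_step s t \<Longrightarrow> stdz 0 s t"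
  by (induction rule: need_step.induct)
    (auto intro: beta_need_stdz stdz_LamI stdz_AppI stdz_refl stdz_Suc)

section \<open>Standard steps are standard reductions\<close>

text \<open>Fits an outer context to an inner one that consumes fewer arguments: the surplus
  outermost applications go into the evaluation context.\<close>

lemma outer_k_split:
  "q \<le> m \<Longrightarrow> outer_k m Au \<Longrightarrow>
   \<exists>C Au'. Au = cplug C Au' \<and> outer_k (m - q) Au' \<and> (\<forall>E. eval_ctx E \<longrightarrow> eval_ctx (cplug C E))"
proof (induction q arbitrary: m Au)
  case 0
  then show ?case by (intro exI[of _ Hole] exI[of _ Au]) auto
next
  case (Suc q)
  then obtain n where n: "m = Suc n" by (cases m) auto
  then obtain A B e where B: "Au = CAppL (cplug A B) e" "ans_ctx A" "outer_k n B"
    using Suc(3) by (auto elim: outer_k_SucE)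
  then obtain C Au' where C: "B = cplug C Au'" "outer_k (n - q) Au'"
    "\<forall>E. eval_ctx E \<longrightarrow> eval_ctx (cplug C E)"
    using Suc(1)[of n B] Suc(2) n by auto
  show ?case
    by (intro exI[of _ "CAppL (cplug A C) e"] exI[of _ Au'])
      (use B C n in \<open>auto intro: eval_ctx.intros\<close>)
qed

text \<open>The function in the last production for evaluation contexts, as found by
  \<open>status (Suc m) f = Pend 0 q\<close>: \<open>m\<close> omits the argument applied to
  \<open>f\<close> itself, and the inner context leaves \<open>q\<close> of the \<open>m\<close>
  others.\<close>

definition demands :: "nat \<Rightarrow> dB \<Rightarrow> nat \<Rightarrow> bool" where
  "demands m f q \<longleftrightarrow> q \<le> m \<and> (\<exists>A Ad E. ans_ctx A \<and> inner_k (m - q) Ad \<and> eval_ctx E \<and>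
     f = plug A (Lam (plug Ad (plug E (Var (depth Ad + depth E))))))"

lemma demands_ans_ctx: "demands m f q \<Longrightarrow> ans_ctx A \<Longrightarrow> demands m (plug A f) q"
  unfolding demands_def using ans_ctx_cplug by (metis plug_cplug)

text \<open>As \<open>p \<le> q\<close>, the \<open>m - q\<close> arguments that \<open>f\<close>
  consumes are all supplied by \<open>Au\<close>; its \<open>q - p\<close> outermost applications
  are split off so that the counts match.\<close>

lemma eval_ctx_arg:
  assumes "outer_k (m - p) Au" "demands m f q" "p \<le> q" "eval_ctx E"
  shows "eval_ctx (cplug Au (CAppR f E))"
proof -
  obtain A Ad E1 where f: "q \<le> m" "ans_ctx A" "inner_k (m - q) Ad" "eval_ctx E1"
    "f = plug A (Lam (plug Ad (plug E1 (Var (depth Ad + depth E1)))))"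
    using assms(2) unfolding demands_def by blast
  then obtain C Au' where C: "Au = cplug C Au'" "outer_k (m - p - (q - p)) Au'"
    "\<forall>E. eval_ctx E \<longrightarrow> eval_ctx (cplug C E)"
    using outer_k_split[OF _ assms(1), of "q - p"] diff_le_mono[OF f(1), of p] by blast
  then have Au': "outer_k (m - q) Au'" using assms(3) by simp
  have "eval_ctx (cplug Au' (CAppR f E))"
    unfolding f(5) using outer_k_imp_outer_ctx[OF Au'] f(2) inner_k_imp_inner_ctx[OF f(3)] f(4)
      assms(4) ans_ctx_outer_inner[OF Au' f(3)] by (rule eval_ctx.intros(4))
  then show ?thesis using C by simp
qed

lemma outer_k_eval_ctx: "outer_k m Au \<Longrightarrow> eval_ctx Au"
  by (induction rule: outer_k.induct) (auto intro: eval_ctx.intros)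

text \<open>The spine ends in the variable or is left at an argument. Only the first alternative
  contains \<open>p \<le> q\<close>; its failure in the second is the situation behind
  \<open>Bad\<close>.\<close>

definition demands_free :: "nat \<Rightarrow> dB \<Rightarrow> nat \<Rightarrow> nat \<Rightarrow> nat \<Rightarrow> bool" where
  "demands_free l t x p q \<longleftrightarrow>
    (\<exists>C m. path l C m p \<and> p \<le> q \<and> t = plug C (Var (x + depth C))) \<or>
    (\<exists>C m f E. path l C m p \<and> demands m f q \<and> eval_ctx E \<and>
       t = plug C (App f (plug E (Var (x + depth C + depth E)))))"

text \<open>After cutting the path at its minimum, the balanced and outer pieces go into the
  evaluation context, by \<open>eval_ctx_arg\<close> if the spine is left at an argument.\<close>

lemma demands_free_good:
  assumes "demands_free l t x p q" "p \<le> q"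
  obtains Ad E where "p \<le> l" "inner_k (l - p) Ad" "eval_ctx E"
    "t = plug Ad (plug E (Var (x + depth Ad + depth E)))"
  using assms(1) unfolding demands_free_def
proof (elim disjE exE conjE)
  fix C m assume C: "path l C m p" and t: "t = plug C (Var (x + depth C))"
  obtain Ad A Au where "C = cplug Ad (cplug A Au)" "inner_k (l - p) Ad" "ans_ctx A" "outer_k (m - p) Au"
    using path_decompose[OF C] by blast
  then show thesis using that[of Ad "cplug A Au"] path_min_le[OF C] t
    by (auto intro: eval_ctx.intros outer_k_eval_ctx simp: add.assoc)
next
  fix C m f E assume C: "path l C m p" and f: "demands m f q" and E: "eval_ctx E"
    and t: "t = plug C (App f (plug E (Var (x + depth C + depth E))))"
  obtain Ad A Au where "C = cplug Ad (cplug A Au)" "inner_k (l - p) Ad" "ans_ctx A" "outer_k (m - p) Au"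
    using path_decompose[OF C] by blast
  moreover from this have "eval_ctx (cplug A (cplug Au (CAppR f E)))"
    using eval_ctx_arg f E assms(2) by (blast intro: eval_ctx.intros)
  ultimately show thesis using that[of Ad "cplug A (cplug Au (CAppR f E))"] path_min_le[OF C] t
    by (auto simp: add.assoc)
qed

text \<open>Reads the contexts of the grammar off the head. The claims need each other: an
  abstraction turns a demand for its variable into \<open>Pend\<close>, and an application whose
  argument demands a variable turns \<open>Pend\<close> into \<open>Free\<close>.\<close>

lemma status_demands:
  "(\<forall>x p q. status l t = Free x p q \<longrightarrow> demands_free l t x p q) \<and>
   (\<forall>j p. status l t = Pend j p \<longrightarrow> (\<exists>Ad f. inner_k j Ad \<and> demands (l - Suc j) f p \<and> t = plug Ad f))"
proof (induction l t rule: status.induct)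
  case (1 l x)
  have "demands_free l (Var x) x l l"
    unfolding demands_free_def using path_Hole by (metis add_0_right depth.simps(1) order_refl plug.simps(1))
  then show ?case by simp
next
  case (2 b)
  then show ?case by simp
next
  case (3 l b)
  show ?case
  proof (intro conjI allI impI)
    fix x p q assume "status (Suc l) (Lam b) = Free x p q"
    then have "status l b = Free (Suc x) p q"
      by (cases "status l b") (auto split: nat.splits if_splits)
    then have "demands_free l b (Suc x) p q" using 3 by blast
    then show "demands_free (Suc l) (Lam b) x p q"
      unfolding demands_free_def
    proof (elim disjE exE conjE)
      fix C m assume "path l C m p" "p \<le> q" "b = plug C (Var (Suc x + depth C))"
      then have "path (Suc l) (CLam C) m p \<and> p \<le> q \<and> Lam b = plug (CLam C) (Var (x + depth (CLam C)))"
        by (auto intro: path.intros)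
      then show "(\<exists>C m. path (Suc l) C m p \<and> p \<le> q \<and> Lam b = plug C (Var (x + depth C))) \<or>
        (\<exists>C m f E. path (Suc l) C m p \<and> demands m f q \<and> eval_ctx E \<and>
          Lam b = plug C (App f (plug E (Var (x + depth C + depth E)))))" by blast
    next
      fix C m f E assume "path l C m p" "demands m f q" "eval_ctx E"
        "b = plug C (App f (plug E (Var (Suc x + depth C + depth E))))"
      then have "path (Suc l) (CLam C) m p \<and> demands m f q \<and> eval_ctx E \<and>
          Lam b = plug (CLam C) (App f (plug E (Var (x + depth (CLam C) + depth E))))"
        by (auto intro: path.intros)
      then show "(\<exists>C m. path (Suc l) C m p \<and> p \<le> q \<and> Lam b = plug C (Var (x + depth C))) \<or>
        (\<exists>C m f E. path (Suc l) C m p \<and> demands m f q \<and> eval_ctx E \<and>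
          Lam b = plug C (App f (plug E (Var (x + depth C + depth E)))))" by blast
    qed
  next
    fix j p assume *: "status (Suc l) (Lam b) = Pend j p"
    show "\<exists>Ad f. inner_k j Ad \<and> demands (Suc l - Suc j) f p \<and> Lam b = plug Ad f"
    proof (cases j)
      case 0
      then obtain q where q: "p \<le> q" "status l b = Free 0 p q" using * by (auto simp del: status.simps)
      then have "demands_free l b 0 p q" using 3 by blast
      from demands_free_good[OF this q(1)] obtain Ad E where "p \<le> l" "inner_k (l - p) Ad" "eval_ctx E"
        "b = plug Ad (plug E (Var (depth Ad + depth E)))" by auto
      then have "demands l (Lam b) p"
        unfolding demands_def using ans_ctx.intros(1) by (metis plug.simps(1))
      then show ?thesis using 0 inner_k.intros(1) by (intro exI[of _ Hole]) auto
    next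
      case (Suc i)
      then have "status l b = Pend i p" using * by (simp del: status.simps)
      then obtain Ad f where "inner_k i Ad" "demands (l - Suc i) f p" "b = plug Ad f" using 3 by blast
      then show ?thesis using Suc inner_k.intros(2)[OF ans_ctx.intros(1), of i Ad]
        by (intro exI[of _ "CLam Ad"]) auto
    qed
  qed
next
  case (4 l f u)
  show ?case
  proof (intro conjI allI impI)
    fix x p q assume *: "status l (App f u) = Free x p q"
    consider p' where "status (Suc l) f = Free x p' q" "p = min l p'"
      | p2 q2 where "status (Suc l) f = Pend 0 q" "status 0 u = Free x p2 q2" "p = l"
      using * by (cases "status (Suc l) f"; cases "status 0 u") (auto split: nat.splits)
    then show "demands_free l (App f u) x p q"
    proof cases
      case 1
      then have "demands_free (Suc l) f x p' q" using 4(1) by blast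
      then show ?thesis
        unfolding demands_free_def
      proof (elim disjE exE conjE)
        fix C m assume "path (Suc l) C m p'" "p' \<le> q" "f = plug C (Var (x + depth C))"
        then have "path l (CAppL C u) m p \<and> p \<le> q \<and>
            App f u = plug (CAppL C u) (Var (x + depth (CAppL C u)))"
          using 1 by (auto intro: path.intros)
        then show "(\<exists>C m. path l C m p \<and> p \<le> q \<and> App f u = plug C (Var (x + depth C))) \<or>
          (\<exists>C m g E. path l C m p \<and> demands m g q \<and> eval_ctx E \<and>
            App f u = plug C (App g (plug E (Var (x + depth C + depth E)))))" by blast
      next
        fix C m g E assume "path (Suc l) C m p'" "demands m g q" "eval_ctx E"
          "f = plug C (App g (plug E (Var (x + depth C + depth E))))"
        then have "path l (CAppL C u) m p \<and> demands m g q \<and> eval_ctx E \<and>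
            App f u = plug (CAppL C u) (App g (plug E (Var (x + depth (CAppL C u) + depth E))))"
          using 1 by (auto intro: path.intros)
        then show "(\<exists>C m. path l C m p \<and> p \<le> q \<and> App f u = plug C (Var (x + depth C))) \<or>
          (\<exists>C m g E. path l C m p \<and> demands m g q \<and> eval_ctx E \<and>
            App f u = plug C (App g (plug E (Var (x + depth C + depth E)))))" by blast
      qed
    next
      case 2
      then obtain Ad g where "inner_k 0 Ad" "demands l g q" "f = plug Ad g" using 4(1) by fastforce
      then have f: "demands l f q" by (auto elim: inner_k_0E)
      have u: "demands_free 0 u x p2 q2" using 4(2)[OF 2(1)] 2 by blast
      \<comment> \<open>Without pending arguments the minimum is 0, so \<open>p2 \<le> q2\<close>
        and \<open>u\<close> is an evaluation context around the variable.\<close>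
      then have "p2 \<le> 0" unfolding demands_free_def using path_min_le by blast
      then obtain Ad E where "inner_k 0 Ad" "eval_ctx E" "u = plug Ad (plug E (Var (x + depth Ad + depth E)))"
        using demands_free_good[OF u] by auto
      then have E: "eval_ctx E" "u = plug E (Var (x + depth E))" by (auto elim: inner_k_0E)
      then have "path l Hole l p \<and> demands l f q \<and> eval_ctx E \<and>
          App f u = plug Hole (App f (plug E (Var (x + depth Hole + depth E))))"
        using 2 f path_Hole by simp
      then show ?thesis unfolding demands_free_def by blast
    qed
  next
    fix j p assume "status l (App f u) = Pend j p"
    then have "status (Suc l) f = Pend (Suc j) p" by (simp del: status.simps)
    then obtain Ad g where Ad: "inner_k (Suc j) Ad" "demands (l - Suc j) g p" "f = plug Ad g"
      using 4(1) by fastforce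
    then obtain A Ad' where A: "Ad = cplug A (CLam Ad')" "ans_ctx A" "inner_k j Ad'"
      by (auto elim: inner_k_SucE)
    \<comment> \<open>The application and the abstraction consuming \<open>u\<close> form an answer
      context, absorbed by the inner context, or by \<open>g\<close> if that is empty.\<close>
    define A' where "A' = CAppL (cplug A (CLam Hole)) u"
    have A': "ans_ctx A'" unfolding A'_def using A by (blast intro: ans_ctx.intros)
    have eq: "App f u = plug A' (plug Ad' g)" unfolding A'_def using A Ad by simp
    show "\<exists>Ad g. inner_k j Ad \<and> demands (l - Suc j) g p \<and> App f u = plug Ad g"
    proof (cases j)
      case 0
      then have "App f u = plug Hole (plug A' g)" using eq A(3) by (auto elim: inner_k_0E)
      then show ?thesis using 0 demands_ans_ctx[OF Ad(2) A'] inner_k.intros(1) by blast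
    next
      case (Suc i)
      then have "inner_k j (cplug A' Ad')" using A(3) A' inner_k_ans_ctx by blast
      then show ?thesis using Ad(2) eq by (metis plug_cplug)
    qed
  qed
qed

lemma status_Pend_0_demands:
  assumes "status (Suc l) f = Pend 0 p"
  shows "demands l f p"
  using status_demands[of "Suc l" f] assms by (auto elim: inner_k_0E)

text \<open>The invariant for descending the spine, where the redex may still use arguments from
  outside; \<open>u\<close> has none pending, so a full \<open>sr_step\<close> can be asked of
  it.\<close>

definition std_redex :: "nat \<Rightarrow> dB \<Rightarrow> bool" where
  "std_redex l t \<longleftrightarrow>
    (\<exists>C m p q f u. path l C m p \<and> demands m f q \<and> t = plug C (App f u) \<and>
      (status 0 u = Ans \<and> std l t = plug C (contr 0 f u) \<or>
       sr_step u (std 0 u) \<and> std l t = plug C (App f (std 0 u))))"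

lemma std_redex_sr_step:
  assumes "std_redex 0 t"
  shows "sr_step t (std 0 t)"
proof -
  obtain C m p q f u where C: "path 0 C m p" and f: "demands m f q" and t: "t = plug C (App f u)"
    and u: "status 0 u = Ans \<and> std 0 t = plug C (contr 0 f u) \<or>
       sr_step u (std 0 u) \<and> std 0 t = plug C (App f (std 0 u))"
    using assms unfolding std_redex_def by blast
  obtain A Au where A: "C = cplug A Au" "ans_ctx A" "outer_k m Au" using path_0_decompose[OF C] by blast
  from u show ?thesis
  proof (elim disjE conjE)
    assume u: "status 0 u = Ans" and std: "std 0 t = plug C (contr 0 f u)"
    obtain A1 Ad E where f: "q \<le> m" "ans_ctx A1" "inner_k (m - q) Ad" "eval_ctx E"
      "f = plug A1 (Lam (plug Ad (plug E (Var (depth Ad + depth E)))))"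
      using f unfolding demands_def by blast
    \<comment> \<open>\<open>Au\<close> offers \<open>m\<close> arguments and \<open>f\<close>
      consumes \<open>m - q\<close>; the outer \<open>q\<close> applications form \<open>D\<close>,
      and the rest meets the side condition of the axiom.\<close>
    obtain D Au' where D: "Au = cplug D Au'" "outer_k (m - q) Au'"
      "\<forall>E. eval_ctx E \<longrightarrow> eval_ctx (cplug D E)"
      using outer_k_split[OF f(1) A(3)] by blast
    obtain A2 v where v: "ans_ctx A2" "is_value v" "u = plug A2 v"
      using u is_answer_iff_status is_answer_def by blast
    have "beta_need (plug Au' (App f u)) (plug Au' (contr 0 f u))"
      unfolding f(5) v(3) contr_redex[OF f(2) v(1,2)]
      using outer_k_imp_outer_ctx[OF D(2)] f(2) inner_k_imp_inner_ctx[OF f(3)] f(4) v(1,2)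
        ans_ctx_outer_inner[OF D(2) f(3)] refl by (rule beta_need.intros)
    moreover have "eval_ctx (cplug A D)"
      using D(3) eval_ctx.intros(1,3) A(2) by (metis cplug_Hole)
    ultimately show ?thesis unfolding sr_step_def using t std A(1) D(1)
      by (metis plug_cplug)
  next
    assume "sr_step u (std 0 u)" and std: "std 0 t = plug C (App f (std 0 u))"
    then obtain E e e' where E: "eval_ctx E" "beta_need e e'" "u = plug E e" "std 0 u = plug E e'"
      unfolding sr_step_def by blast
    have "eval_ctx (cplug A (cplug Au (CAppR f E)))"
      using eval_ctx_arg[of m 0 Au f q E] A f E(1) by (auto intro: eval_ctx.intros)
    moreover have "t = plug (cplug A (cplug Au (CAppR f E))) e"
      "std 0 t = plug (cplug A (cplug Au (CAppR f E))) e'"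
      using t std A(1) E by simp_all
    ultimately show ?thesis unfolding sr_step_def using E(2) by blast
  qed
qed

lemma status_Red_std_redex: "status l t = Red \<Longrightarrow> std_redex l t"
proof (induction l t rule: status.induct)
  case (3 l b)
  then have "status l b = Red" by (simp del: status.simps)
  then have "std_redex l b" using 3 by blast
  then obtain C m p q f u where C: "path l C m p" "demands m f q" "b = plug C (App f u)"
    "status 0 u = Ans \<and> std l b = plug C (contr 0 f u) \<or>
       sr_step u (std 0 u) \<and> std l b = plug C (App f (std 0 u))"
    unfolding std_redex_def by blast
  then show ?case unfolding std_redex_def
    by (intro exI[of _ "CLam C"] exI[of _ m] exI[of _ p] exI[of _ q] exI[of _ f] exI[of _ u])
      (auto intro: path.intros)
next
  case (4 l f u)
  from 4(3) show ?case
  proof (cases rule: status_App_Red_cases)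
    case func
    then have "std_redex (Suc l) f" using 4(1) by blast
    then obtain C m p q g w where C: "path (Suc l) C m p" "demands m g q" "f = plug C (App g w)"
      "status 0 w = Ans \<and> std (Suc l) f = plug C (contr 0 g w) \<or>
         sr_step w (std 0 w) \<and> std (Suc l) f = plug C (App g (std 0 w))"
      unfolding std_redex_def by blast
    have "path l (CAppL C u) m (min l p)" using C(1) by (rule path.intros)
    moreover have "App f u = plug (CAppL C u) (App g w)" using C(3) by simp
    moreover have "std l (App f u) = App (std (Suc l) f) u" using func by simp
    ultimately show ?thesis unfolding std_redex_def using C(2,4) by (metis plug.simps(3))
  next
    case (redex p)
    then have "std l (App f u) = plug Hole (contr 0 f u)" by simp
    then show ?thesis unfolding std_redex_def
      using path_Hole status_Pend_0_demands[OF redex(1)] redex(2) by (metis plug.simps(1))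
  next
    case (arg p)
    then have "sr_step u (std 0 u)" using 4(2) std_redex_sr_step by blast
    moreover have "std l (App f u) = plug Hole (App f (std 0 u))" using arg by simp
    ultimately show ?thesis unfolding std_redex_def
      using path_Hole status_Pend_0_demands[OF arg(1)] by (metis plug.simps(1))
  qed
qed auto

lemma ssteps_sr_steps: "ssteps 0 s t \<Longrightarrow> sr_step\<^sup>*\<^sup>* s t"
  by (rule mono_rtranclp[rule_format, of "sstep 0"])
    (auto simp: sstep_def intro: std_redex_sr_step status_Red_std_redex)

lemma need_step_plug: "need_step s t \<Longrightarrow> need_step (plug C s) (plug C t)"
  by (induction C) (auto intro: need_step.intros)

lemma sr_steps_need_eq: "sr_step\<^sup>*\<^sup>* s t \<Longrightarrow> need_eq s t"
proof (induction rule: rtranclp_induct)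
  case base
  then show ?case by (simp add: need_eq_def)
next
  case (step t u)
  then have "need_step t u" by (auto simp: sr_step_def intro: need_step_plug need_step.intros(1))
  then show ?case using step(3) unfolding need_eq_def
    by (meson equivclp_trans r_into_equivclp)
qed

lemma need_eq_halts_iff: "need_eq s t \<Longrightarrow> halts s \<longleftrightarrow> halts t"
  unfolding need_eq_def
  by (induction rule: equivclp_induct) (auto dest: need_step_stdz simp: stdz_halts_iff)

theorem theorem2:
  shows "eval_need_done e \<longleftrightarrow> eval_sr_need_done e"
proof
  assume "eval_need_done e"
  then obtain a where "status 0 a = Ans" "need_eq e a"
    unfolding eval_need_done_def is_answer_iff_status by blast
  then have "halts e" using need_eq_halts_iff unfolding halts_def by blast
  then show "eval_sr_need_done e"
    unfolding eval_sr_need_done_def halts_def is_answer_iff_status using ssteps_sr_steps by blast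
next
  assume "eval_sr_need_done e"
  then show "eval_need_done e"
    unfolding eval_sr_need_done_def eval_need_done_def using sr_steps_need_eq by blast
qed

end
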